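(* Let $V$ be a strongly left distributive hypervector space over a hyperfield $F$, and suppose $V$ is generated by a linearly dependent set $\{\alpha_1,\alpha_2,\dots,\alpha_n\}\subseteq V$. Then $V$ is also generated by some proper subset of $\{\alpha_1,\alpha_2,\dots,\alpha_n\}$.
   Context: A hyperoperation on a non-empty set $X$ is a map $X\times X\to P^*(X)$, where $P^*(X)$ is the set of non-empty subsets of $X$. All operations are extended to subsets by unions, e.g. $A\# B=\bigcup_{a\in A,b\in B}a\# b$, $a\ast A=\bigcup_{\alpha\in A}a\ast\alpha$, $B\ast\alpha=\bigcup_{b\in B}b\ast\alpha$; singletons are identified with their elements. A commutative hypergroup $(X,\#)$ is a non-empty set with a commutative hyperoperation such that (1) $x\#(y\# z)=(x\# y)\# z$; (2) there is $0\in X$ such that for every $a\in X$ there is a unique $b\in X$ with $0\in a\# b$ and $0\in b\# a$, and this $b$ is denoted $-a$; (3) $a\in b\# c$ implies $b\in a\#(-c)$. (The zero element is then unique.) A hyperfield $(F,\oplus,\cdot)$ is a commutative hypergroup $(F,\oplus)$ with zero element $0$ together with a single-valued, associative, commutative multiplication $\cdot$ that distributes over $\oplus$ (equality of sets, both sides), with $a\cdot 0=0\cdot a=0$ for all $a$, with an identity $1_F$, and such that each $a\ne0$ has $a^{-1}$ with $a\cdot a^{-1}=1_F$. A hypervector space $V$ over $F$ is a commutative hypergroup $(V,\#)$ with zero vector $\theta$, together with a map $\ast:F\times V\to P^*(V)$ such that for all $a,b\in F$, $\alpha,\beta\in V$: (i) $a\ast(\alpha\#\beta)\subseteq a\ast\alpha\#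 a\ast\beta$; (ii) $(a\oplus b)\ast\alpha\subseteq a\ast\alpha\# b\ast\alpha$; (iii) $(a\cdot b)\ast\alpha=a\ast(b\ast\alpha)$; (iv) $1_F\ast\alpha=\{\alpha\}$ and $0\ast\alpha=\{\theta\}$. It is strongly left distributive if equality always holds in (ii). Vectors $\alpha_1,\dots,\alpha_n$ (or the set of them) are linearly dependent if there are $a_1,\dots,a_n\in F$, not all zero, with $\theta\in a_1\ast\alpha_1\#\cdots\# a_n\ast\alpha_n$. $V$ is generated by a finite set $\{\gamma_1,\dots,\gamma_k\}$ if $V=HL(\gamma_1,\dots,\gamma_k):=\bigcup\{a_1\ast\gamma_1\#\cdots\# a_k\ast\gamma_k: a_1,\dots,a_k\in F\}$; by convention $HL(\emptyset)=\{\theta\}$. *)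

theory Defs
  imports "HOL-Algebra.Congruence"
begin

record 'a hypergroup = "'a partial_object" +
  hadd :: "['a, 'a] \<Rightarrow> 'a set" (infixl "\<boxplus>\<index>" 65)
  hzero :: 'a ("\<zero>\<index>")

definition set_hadd :: "('a, 'm) hypergroup_scheme \<Rightarrow> 'a set \<Rightarrow> 'a set \<Rightarrow> 'a set"
    (infixl "\<uplus>\<index>" 65)
  where "A \<uplus>\<^bsub>X\<^esub> B = (\<Union>a\<in>A. \<Union>b\<in>B. a \<boxplus>\<^bsub>X\<^esub> b)"

definition hneg :: "('a, 'm) hypergroup_scheme \<Rightarrow> 'a \<Rightarrow> 'a" ("\<boxminus>\<index> _" [81] 80)
  where "\<boxminus>\<^bsub>X\<^esub> a = (THE b. b \<in> carrier X \<and> \<zero>\<^bsub>X\<^esub> \<in> a \<boxplus>\<^bsub>X\<^esub> b \<and> \<zero>\<^bsub>X\<^esub> \<in> b \<boxplus>\<^bsub>X\<^esub> a)"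

locale commutative_hypergroup =
  fixes X :: "('a, 'm) hypergroup_scheme" (structure)
  assumes hadd_closed: "a \<in> carrier X \<Longrightarrow> b \<in> carrier X \<Longrightarrow> a \<boxplus> b \<subseteq> carrier X"
    and hadd_nonempty: "a \<in> carrier X \<Longrightarrow> b \<in> carrier X \<Longrightarrow> a \<boxplus> b \<noteq> {}"
    and hadd_comm: "a \<in> carrier X \<Longrightarrow> b \<in> carrier X \<Longrightarrow> a \<boxplus> b = b \<boxplus> a"
    and hadd_assoc: "x \<in> carrier X \<Longrightarrow> y \<in> carrier X \<Longrightarrow> z \<in> carrier X \<Longrightarrow>
      {x} \<uplus> (y \<boxplus> z) = (x \<boxplus> y) \<uplus> {z}"
    and hzero_closed: "\<zero> \<in> carrier X"
    and hneg_ex1: "a \<in> carrier X \<Longrightarrow> \<exists>!b. b \<in> carrier X \<and> \<zero> \<in> a \<boxplus> b \<and> \<zero> \<in> b \<boxplus> a"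
    and reversible: "a \<in> carrier X \<Longrightarrow> b \<in> carrier X \<Longrightarrow> c \<in> carrier X \<Longrightarrow>
      a \<in> b \<boxplus> c \<Longrightarrow> b \<in> a \<boxplus> (\<boxminus> c)"

record 'a hyperfield = "'a hypergroup" +
  hmult :: "['a, 'a] \<Rightarrow> 'a" (infixl "\<odot>\<index>" 70)
  hone :: 'a ("\<one>\<index>")

(* The condition one \<noteq> zero is deliberately not imposed. *)
locale hyperfield = commutative_hypergroup F
  for F :: "('a, 'm) hyperfield_scheme" (structure) +
  assumes hmult_closed: "a \<in> carrier F \<Longrightarrow> b \<in> carrier F \<Longrightarrow> a \<odot> b \<in> carrier F"
    and hmult_assoc: "a \<in> carrier F \<Longrightarrow> b \<in> carrier F \<Longrightarrow> c \<in> carrier F \<Longrightarrow>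
      (a \<odot> b) \<odot> c = a \<odot> (b \<odot> c)"
    and hmult_comm: "a \<in> carrier F \<Longrightarrow> b \<in> carrier F \<Longrightarrow> a \<odot> b = b \<odot> a"
    and distrib_left: "a \<in> carrier F \<Longrightarrow> b \<in> carrier F \<Longrightarrow> c \<in> carrier F \<Longrightarrow>
      (\<lambda>x. a \<odot> x) ` (b \<boxplus> c) = (a \<odot> b) \<boxplus> (a \<odot> c)"
    and distrib_right: "a \<in> carrier F \<Longrightarrow> b \<in> carrier F \<Longrightarrow> c \<in> carrier F \<Longrightarrow>
      (\<lambda>x. x \<odot> a) ` (b \<boxplus> c) = (b \<odot> a) \<boxplus> (c \<odot> a)"
    and hmult_zero: "a \<in> carrier F \<Longrightarrow> a \<odot> \<zero> = \<zero>" "a \<in> carrier F \<Longrightarrow> \<zero> \<odot> a = \<zero>"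
    and hone_closed: "\<one> \<in> carrier F"
    and hmult_one: "a \<in> carrier F \<Longrightarrow> a \<odot> \<one> = a" "a \<in> carrier F \<Longrightarrow> \<one> \<odot> a = a"
    and hinverse_ex: "a \<in> carrier F \<Longrightarrow> a \<noteq> \<zero> \<Longrightarrow> \<exists>b\<in>carrier F. a \<odot> b = \<one>"

record ('f, 'v) hypervector_space = "'v hypergroup" +
  hsmul :: "['f, 'v] \<Rightarrow> 'v set" (infixr "\<circledast>\<index>" 75)

(* In smult_assoc the right-hand side is a * (b * \<alpha>), the outer scalar action
   being extended to the set b * \<alpha> by unions; similarly in the other axioms. *)
locale hypervector_space = F?: hyperfield F + V?: commutative_hypergroup V
  for F :: "('f, 'm) hyperfield_scheme" and V :: "('f, 'v, 'n) hypervector_space_scheme" +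
  assumes hsmul_closed: "a \<in> carrier F \<Longrightarrow> \<alpha> \<in> carrier V \<Longrightarrow> a \<circledast>\<^bsub>V\<^esub> \<alpha> \<subseteq> carrier V"
    and hsmul_nonempty: "a \<in> carrier F \<Longrightarrow> \<alpha> \<in> carrier V \<Longrightarrow> a \<circledast>\<^bsub>V\<^esub> \<alpha> \<noteq> {}"
    and smult_r_distr: "a \<in> carrier F \<Longrightarrow> \<alpha> \<in> carrier V \<Longrightarrow> \<beta> \<in> carrier V \<Longrightarrow>
      (\<Union>\<gamma>\<in>\<alpha> \<boxplus>\<^bsub>V\<^esub> \<beta>. a \<circledast>\<^bsub>V\<^esub> \<gamma>) \<subseteq> (a \<circledast>\<^bsub>V\<^esub> \<alpha>) \<uplus>\<^bsub>V\<^esub> (a \<circledast>\<^bsub>V\<^esub> \<beta>)"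
    and smult_l_distr: "a \<in> carrier F \<Longrightarrow> b \<in> carrier F \<Longrightarrow> \<alpha> \<in> carrier V \<Longrightarrow>
      (\<Union>c\<in>a \<boxplus>\<^bsub>F\<^esub> b. c \<circledast>\<^bsub>V\<^esub> \<alpha>) \<subseteq> (a \<circledast>\<^bsub>V\<^esub> \<alpha>) \<uplus>\<^bsub>V\<^esub> (b \<circledast>\<^bsub>V\<^esub> \<alpha>)"
    and smult_assoc: "a \<in> carrier F \<Longrightarrow> b \<in> carrier F \<Longrightarrow> \<alpha> \<in> carrier V \<Longrightarrow>
      (a \<odot>\<^bsub>F\<^esub> b) \<circledast>\<^bsub>V\<^esub> \<alpha> = (\<Union>\<beta>\<in>b \<circledast>\<^bsub>V\<^esub> \<alpha>. a \<circledast>\<^bsub>V\<^esub> \<beta>)"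
    and smult_one: "\<alpha> \<in> carrier V \<Longrightarrow> \<one>\<^bsub>F\<^esub> \<circledast>\<^bsub>V\<^esub> \<alpha> = {\<alpha>}"
    and smult_zero: "\<alpha> \<in> carrier V \<Longrightarrow> \<zero>\<^bsub>F\<^esub> \<circledast>\<^bsub>V\<^esub> \<alpha> = {\<zero>\<^bsub>V\<^esub>}"

definition strongly_left_distributive ::
    "('f, 'm) hyperfield_scheme \<Rightarrow> ('f, 'v, 'n) hypervector_space_scheme \<Rightarrow> bool"
  where "strongly_left_distributive F V \<longleftrightarrow>
    (\<forall>a\<in>carrier F. \<forall>b\<in>carrier F. \<forall>\<alpha>\<in>carrier V.
      (\<Union>c\<in>a \<boxplus>\<^bsub>F\<^esub> b. c \<circledast>\<^bsub>V\<^esub> \<alpha>) = (a \<circledast>\<^bsub>V\<^esub> \<alpha>) \<uplus>\<^bsub>V\<^esub> (b \<circledast>\<^bsub>V\<^esub> \<alpha>))"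

(* The hypersum of a list of sets; bracketing and order are immaterial in a
   commutative hypergroup. The value on the empty list encodes HL({}) = {\<theta>}. *)
fun hsum :: "('v, 'n) hypergroup_scheme \<Rightarrow> 'v set list \<Rightarrow> 'v set" where
  "hsum V [] = {\<zero>\<^bsub>V\<^esub>}"
| "hsum V [A] = A"
| "hsum V (A # B # As) = A \<uplus>\<^bsub>V\<^esub> hsum V (B # As)"

definition hlincomb :: "('f, 'v, 'n) hypervector_space_scheme \<Rightarrow> 'f list \<Rightarrow> 'v list \<Rightarrow> 'v set"
  where "hlincomb V as \<alpha>s = hsum V (map2 (\<lambda>a \<alpha>. a \<circledast>\<^bsub>V\<^esub> \<alpha>) as \<alpha>s)"

definition lin_dependent ::
    "('f, 'm) hyperfield_scheme \<Rightarrow> ('f, 'v, 'n) hypervector_space_scheme \<Rightarrow> 'v list \<Rightarrow> bool"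
  where "lin_dependent F V \<alpha>s \<longleftrightarrow>
    (\<exists>as. length as = length \<alpha>s \<and> set as \<subseteq> carrier F \<and> (\<exists>a\<in>set as. a \<noteq> \<zero>\<^bsub>F\<^esub>) \<and>
      \<zero>\<^bsub>V\<^esub> \<in> hlincomb V as \<alpha>s)"

definition HL ::
    "('f, 'm) hyperfield_scheme \<Rightarrow> ('f, 'v, 'n) hypervector_space_scheme \<Rightarrow> 'v list \<Rightarrow> 'v set"
  where "HL F V \<gamma>s =
    \<Union> {hlincomb V as \<gamma>s | as. length as = length \<gamma>s \<and> set as \<subseteq> carrier F}"

definition generated_by ::
    "('f, 'm) hyperfield_scheme \<Rightarrow> ('f, 'v, 'n) hypervector_space_scheme \<Rightarrow> 'v list \<Rightarrow> bool"
  where "generated_by F V \<gamma>s \<longleftrightarrow> carrier V = HL F V \<gamma>s"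

end

(* In a dependence relation, the inverse of a non-zero coefficient a expresses its vector x through
   the others: if \<theta> \<in> \<beta> # \<gamma> with \<beta> \<in> a * x and \<gamma> a combination of the other vectors,
   then \<beta> = -\<gamma> \<in> (-1) * \<gamma>, and a^{-1} * \<beta> = {x} because this set is non-empty and
   contained in 1 * x. By strong left distributivity a hyperlinear span is closed under
   hyperaddition, so x may be dropped from the generators. *)

theory Submission
  imports Defs
begin

section \<open>Commutative hypergroups: neutrality of zero and hypersums of sets\<close>

context commutative_hypergroup
begin

lemma hneg_eq:
  assumes "a \<in> carrier X" "b \<in> carrier X" "\<zero> \<in> a \<boxplus> b"
  shows "\<boxminus> a = b"
  unfolding hneg_def
proof (rule the1_equality[OF hneg_ex1[OF assms(1)]])
  show "b \<in> carrier X \<and> \<zero> \<in> a \<boxplus> b \<and> \<zero> \<in> b \<boxplus> a"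
    using assms hadd_comm by auto
qed

lemma hneg_exists:
  assumes "a \<in> carrier X"
  obtains b where "b \<in> carrier X" "\<zero> \<in> a \<boxplus> b"
  using hneg_ex1[OF assms] by blast

text \<open>Neutrality of zero is not an axiom; it follows from reversibility and uniqueness of
  negatives. With \<open>b\<close> the negative of \<open>a\<close>, reversing \<zero> \<in> a
  \<boxplus> b puts \<open>a\<close> into the sum of zero and \<open>a\<close>. Conversely,
  reversing membership of any \<open>c\<close> in that sum gives \<zero> \<in> c \<boxplus> b, so
  \<open>c\<close> and \<open>a\<close> are both the negative of \<open>b\<close>.\<close>

lemma hadd_zero:
  assumes a: "a \<in> carrier X"
  shows "a \<boxplus> \<zero> = {a}"
proof -
  obtain b where b: "b \<in> carrier X" "\<zero> \<in> a \<boxplus> b" by (rule hneg_exists[OF a])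
  have neg_a: "\<boxminus> a = b" by (rule hneg_eq[OF a b])
  have neg_b: "\<boxminus> b = a" using hneg_eq[OF b(1) a] b hadd_comm[OF a b(1)] by simp
  have "a \<in> \<zero> \<boxplus> a"
    using reversible[OF hzero_closed a b] neg_b by simp
  moreover have "c = a" if c: "c \<in> \<zero> \<boxplus> a" for c
  proof -
    have cX: "c \<in> carrier X" using c hadd_closed[OF hzero_closed a] by blast
    have "\<zero> \<in> c \<boxplus> b" using reversible[OF cX hzero_closed a c] neg_a by simp
    then show ?thesis
      using hneg_eq[OF b(1) cX] neg_b hadd_comm[OF cX b(1)] by simp
  qed
  ultimately show ?thesis using hadd_comm[OF a hzero_closed] by blast
qed

lemma set_hadd_closed:
  "A \<subseteq> carrier X \<Longrightarrow> B \<subseteq> carrier X \<Longrightarrow> A \<uplus> B \<subseteq> carrier X"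
  unfolding set_hadd_def using hadd_closed by blast

lemma set_hadd_mono: "A \<subseteq> A' \<Longrightarrow> B \<subseteq> B' \<Longrightarrow> A \<uplus> B \<subseteq> A' \<uplus> B'"
  unfolding set_hadd_def by blast

lemma set_hadd_comm:
  assumes "A \<subseteq> carrier X" "B \<subseteq> carrier X"
  shows "A \<uplus> B = B \<uplus> A"
proof -
  have "a \<boxplus> b = b \<boxplus> a" if "a \<in> A" "b \<in> B" for a b
    using that assms hadd_comm by blast
  then show ?thesis unfolding set_hadd_def by blast
qed

lemma set_hadd_assoc:
  assumes "A \<subseteq> carrier X" "B \<subseteq> carrier X" "C \<subseteq> carrier X"
  shows "(A \<uplus> B) \<uplus> C = A \<uplus> (B \<uplus> C)"
proof -
  \<comment> \<open>Both bracketings are unions over triples of elements, so the axiom for single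
    elements can be applied under the unions.\<close>
  have "(A \<uplus> B) \<uplus> C = (\<Union>a\<in>A. \<Union>b\<in>B. \<Union>c\<in>C. (a \<boxplus> b) \<uplus> {c})"
    unfolding set_hadd_def by blast
  also have "\<dots> = (\<Union>a\<in>A. \<Union>b\<in>B. \<Union>c\<in>C. {a} \<uplus> (b \<boxplus> c))"
    using assms by (intro SUP_cong refl hadd_assoc[symmetric]) auto
  also have "\<dots> = A \<uplus> (B \<uplus> C)"
    unfolding set_hadd_def by blast
  finally show ?thesis .
qed

lemma set_hadd_left_comm:
  assumes "A \<subseteq> carrier X" "B \<subseteq> carrier X" "C \<subseteq> carrier X"
  shows "A \<uplus> (B \<uplus> C) = B \<uplus> (A \<uplus> C)"
  using assms set_hadd_assoc set_hadd_comm by metis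

lemma set_hadd_zero: "A \<subseteq> carrier X \<Longrightarrow> A \<uplus> {\<zero>} = A"
  unfolding set_hadd_def using hadd_zero by auto

text \<open>The recursion of \<open>hsum\<close> stops at a one-element list without adding a zero.
  Neutrality of zero removes this special case, so that later inductions have a single step.\<close>

lemma hsum_Cons: "A \<subseteq> carrier X \<Longrightarrow> hsum X (A # As) = A \<uplus> hsum X As"
  by (cases As) (simp_all add: set_hadd_zero)

lemma hsum_closed: "(\<And>A. A \<in> set As \<Longrightarrow> A \<subseteq> carrier X) \<Longrightarrow> hsum X As \<subseteq> carrier X"
  by (induction As) (simp_all add: hzero_closed hsum_Cons set_hadd_closed)

text \<open>Serves to isolate the summand of the vector that is to be dropped, wherever it stands in
  the list.\<close>

lemma hsum_middle:
  assumes "B \<subseteq> carrier X" "\<And>A. A \<in> set As \<union> set Cs \<Longrightarrow> A \<subseteq> carrier X"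
  shows "hsum X (As @ B # Cs) = B \<uplus> hsum X (As @ Cs)"
  using assms(2)
proof (induction As)
  case Nil
  then show ?case using assms(1) by (simp add: hsum_Cons)
next
  case (Cons A As)
  have A: "A \<subseteq> carrier X" using Cons.prems by simp
  have "hsum X (As @ Cs) \<subseteq> carrier X" using Cons.prems by (intro hsum_closed) auto
  then show ?case
    using Cons A assms(1) by (simp add: hsum_Cons set_hadd_left_comm)
qed

end

section \<open>Linear combinations in a hypervector space\<close>

context hypervector_space
begin

lemma hlincomb_Nil [simp]: "hlincomb V as [] = {\<zero>\<^bsub>V\<^esub>}" "hlincomb V [] xs = {\<zero>\<^bsub>V\<^esub>}"
  by (simp_all add: hlincomb_def)

lemma summands_closed:
  "set as \<subseteq> carrier F \<Longrightarrow> set xs \<subseteq> carrier V \<Longrightarrow>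
    A \<in> set (map2 (\<lambda>a x. a \<circledast>\<^bsub>V\<^esub> x) as xs) \<Longrightarrow> A \<subseteq> carrier V"
  using hsmul_closed by (force elim!: in_set_zipE)

lemma hlincomb_closed:
  "set as \<subseteq> carrier F \<Longrightarrow> set xs \<subseteq> carrier V \<Longrightarrow> hlincomb V as xs \<subseteq> carrier V"
  unfolding hlincomb_def by (rule V.hsum_closed) (rule summands_closed)

lemma hlincomb_Cons:
  "a \<in> carrier F \<Longrightarrow> x \<in> carrier V \<Longrightarrow>
    hlincomb V (a # as) (x # xs) = (a \<circledast>\<^bsub>V\<^esub> x) \<uplus>\<^bsub>V\<^esub> hlincomb V as xs"
  by (simp add: hlincomb_def V.hsum_Cons hsmul_closed)

text \<open>The equal lengths of \<open>as\<close> and \<open>xs\<close> align the two splits, so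
  that the coefficient \<open>a\<close> is paired with \<open>x\<close>.\<close>

lemma hlincomb_middle:
  assumes "length as = length xs"
    and "set as \<union> set bs \<subseteq> carrier F" "set xs \<union> set ys \<subseteq> carrier V"
    and "a \<in> carrier F" "x \<in> carrier V"
  shows "hlincomb V (as @ a # bs) (xs @ x # ys)
    = (a \<circledast>\<^bsub>V\<^esub> x) \<uplus>\<^bsub>V\<^esub> hlincomb V (as @ bs) (xs @ ys)"
proof -
  have "A \<subseteq> carrier V" if "A \<in> set (map2 (\<lambda>a x. a \<circledast>\<^bsub>V\<^esub> x) as xs)
      \<union> set (map2 (\<lambda>a x. a \<circledast>\<^bsub>V\<^esub> x) bs ys)" for A
    using that assms summands_closed[of as xs A] summands_closed[of bs ys A] by blast
  then show ?thesis
    using assms(1)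
      V.hsum_middle[OF hsmul_closed[OF assms(4,5)], of "map2 (\<lambda>a x. a \<circledast>\<^bsub>V\<^esub> x) as xs"
        "map2 (\<lambda>a x. a \<circledast>\<^bsub>V\<^esub> x) bs ys"]
    by (simp add: hlincomb_def)
qed

text \<open>Write the zero vector as the zero scalar times itself; associativity then moves
  \<open>a\<close> onto the zero scalar, which absorbs it.\<close>

lemma smult_vzero:
  assumes "a \<in> carrier F"
  shows "a \<circledast>\<^bsub>V\<^esub> \<zero>\<^bsub>V\<^esub> = {\<zero>\<^bsub>V\<^esub>}"
  using smult_assoc[OF assms F.hzero_closed V.hzero_closed]
  by (simp add: smult_zero V.hzero_closed hmult_zero assms)

text \<open>Here \<open>m\<close> is minus one. Zero lies in the sum of one and \<open>m\<close>, so
  left distributivity puts the zero vector into the sum of \<open>v\<close> and some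
  \<open>w\<close> in \<open>m\<close> times \<open>v\<close>; uniqueness of negatives identifies
  \<open>w\<close>. Only membership is claimed, since \<open>m\<close> times \<open>v\<close> may
  contain further vectors.\<close>

lemma hneg_in_smult:
  assumes m: "m \<in> carrier F" "\<zero>\<^bsub>F\<^esub> \<in> \<one>\<^bsub>F\<^esub> \<boxplus>\<^bsub>F\<^esub> m" and v: "v \<in> carrier V"
  shows "\<boxminus>\<^bsub>V\<^esub> v \<in> m \<circledast>\<^bsub>V\<^esub> v"
proof -
  have "\<zero>\<^bsub>V\<^esub> \<in> (\<Union>c\<in>\<one>\<^bsub>F\<^esub> \<boxplus>\<^bsub>F\<^esub> m. c \<circledast>\<^bsub>V\<^esub> v)"
    using m(2) smult_zero[OF v] by blast
  then have "\<zero>\<^bsub>V\<^esub> \<in> (\<one>\<^bsub>F\<^esub> \<circledast>\<^bsub>V\<^esub> v) \<uplus>\<^bsub>V\<^esub> (m \<circledast>\<^bsub>V\<^esub> v)"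
    using smult_l_distr[OF hone_closed m(1) v] by blast
  then obtain w where w: "w \<in> m \<circledast>\<^bsub>V\<^esub> v" "\<zero>\<^bsub>V\<^esub> \<in> v \<boxplus>\<^bsub>V\<^esub> w"
    by (auto simp: set_hadd_def smult_one[OF v])
  moreover have "w \<in> carrier V" using w(1) hsmul_closed[OF m(1) v] by blast
  ultimately show ?thesis using V.hneg_eq[OF v] by metis
qed

lemma smult_hlincomb:
  assumes c: "c \<in> carrier F" and "set as \<subseteq> carrier F" "set xs \<subseteq> carrier V"
    and "v \<in> hlincomb V as xs"
  shows "c \<circledast>\<^bsub>V\<^esub> v \<subseteq> hlincomb V (map (\<lambda>a. c \<odot>\<^bsub>F\<^esub> a) as) xs"
  using assms(2-)
proof (induction as xs arbitrary: v rule: list_induct2')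
  case (4 a as x xs)
  have a: "a \<in> carrier F" and x: "x \<in> carrier V" using 4 by auto
  obtain u w where u: "u \<in> a \<circledast>\<^bsub>V\<^esub> x" and w: "w \<in> hlincomb V as xs"
    and v: "v \<in> u \<boxplus>\<^bsub>V\<^esub> w"
    using "4.prems"(3) hlincomb_Cons[OF a x] by (auto simp: set_hadd_def)
  have uV: "u \<in> carrier V" using u hsmul_closed[OF a x] by blast
  have wV: "w \<in> carrier V" using w hlincomb_closed[of as xs] 4 by auto
  have "c \<circledast>\<^bsub>V\<^esub> v \<subseteq> (c \<circledast>\<^bsub>V\<^esub> u) \<uplus>\<^bsub>V\<^esub> (c \<circledast>\<^bsub>V\<^esub> w)"
    using smult_r_distr[OF c uV wV] v by blast
  also have "\<dots> \<subseteq> ((c \<odot>\<^bsub>F\<^esub> a) \<circledast>\<^bsub>V\<^esub> x) \<uplus>\<^bsub>V\<^esub> hlincomb V (map (\<lambda>a. c \<odot>\<^bsub>F\<^esub> a) as) xs"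
    using smult_assoc[OF c a x] u "4.IH" "4.prems" w by (intro V.set_hadd_mono) auto
  finally show ?case by (simp add: hlincomb_Cons hmult_closed c a x)
\<comment> \<open>When either list is empty, the combination consists of the zero vector alone,
  which \<open>c\<close> fixes.\<close>
qed (simp_all add: smult_vzero c)

section \<open>Closure of hyperlinear spans\<close>

lemma mem_HL_iff:
  "v \<in> HL F V xs \<longleftrightarrow>
    (\<exists>as. length as = length xs \<and> set as \<subseteq> carrier F \<and> v \<in> hlincomb V as xs)"
  by (auto simp: HL_def)

lemma HL_closed: "set xs \<subseteq> carrier V \<Longrightarrow> HL F V xs \<subseteq> carrier V"
  using hlincomb_closed unfolding HL_def by blast

lemma HL_smult:
  assumes "c \<in> carrier F" "set xs \<subseteq> carrier V" "v \<in> HL F V xs"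
  shows "c \<circledast>\<^bsub>V\<^esub> v \<subseteq> HL F V xs"
proof
  fix w assume w: "w \<in> c \<circledast>\<^bsub>V\<^esub> v"
  obtain as where as: "length as = length xs" "set as \<subseteq> carrier F" "v \<in> hlincomb V as xs"
    using assms(3) by (auto simp: mem_HL_iff)
  have "w \<in> hlincomb V (map (\<lambda>a. c \<odot>\<^bsub>F\<^esub> a) as) xs"
    using smult_hlincomb[OF assms(1) as(2) assms(2) as(3)] w by blast
  moreover have "set (map (\<lambda>a. c \<odot>\<^bsub>F\<^esub> a) as) \<subseteq> carrier F"
    using as(2) assms(1) hmult_closed by auto
  ultimately show "w \<in> HL F V xs"
    unfolding mem_HL_iff using as(1) by (intro exI[of _ "map (\<lambda>a. c \<odot>\<^bsub>F\<^esub> a) as"]) simp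
qed

text \<open>Regrouping brings the two multiples of each vector together, and strong left
  distributivity merges them. The bound is the whole span rather than one combination, because the
  merged coefficient ranges over the set a \<boxplus> b and depends on the element
  considered.\<close>

lemma hlincomb_add:
  assumes sld: "strongly_left_distributive F V"
    and "length as = length bs" "length bs = length xs"
    and "set as \<subseteq> carrier F" "set bs \<subseteq> carrier F" "set xs \<subseteq> carrier V"
  shows "hlincomb V as xs \<uplus>\<^bsub>V\<^esub> hlincomb V bs xs \<subseteq> HL F V xs"
  using assms(2-)
proof (induction as bs xs rule: list_induct3)
  case Nil
  then show ?case by (auto simp: V.set_hadd_zero V.hzero_closed mem_HL_iff)
next
  case (Cons a as b bs x xs)
  have a: "a \<in> carrier F" and b: "b \<in> carrier F" and x: "x \<in> carrier V" using Cons by auto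
  let ?A = "a \<circledast>\<^bsub>V\<^esub> x" and ?B = "b \<circledast>\<^bsub>V\<^esub> x"
  let ?S = "hlincomb V as xs" and ?T = "hlincomb V bs xs"
  have cl: "?A \<subseteq> carrier V" "?B \<subseteq> carrier V" "?S \<subseteq> carrier V" "?T \<subseteq> carrier V"
    using Cons.prems a b x by (simp_all add: hsmul_closed hlincomb_closed)
  have "(?A \<uplus>\<^bsub>V\<^esub> ?S) \<uplus>\<^bsub>V\<^esub> (?B \<uplus>\<^bsub>V\<^esub> ?T) = (?A \<uplus>\<^bsub>V\<^esub> ?B) \<uplus>\<^bsub>V\<^esub> (?S \<uplus>\<^bsub>V\<^esub> ?T)"
    using cl by (simp add: V.set_hadd_assoc V.set_hadd_left_comm V.set_hadd_closed)
  moreover have "w \<in> HL F V (x # xs)"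
    if w: "w \<in> (?A \<uplus>\<^bsub>V\<^esub> ?B) \<uplus>\<^bsub>V\<^esub> (?S \<uplus>\<^bsub>V\<^esub> ?T)" for w
  proof -
    obtain u v where u: "u \<in> ?A \<uplus>\<^bsub>V\<^esub> ?B" and v: "v \<in> ?S \<uplus>\<^bsub>V\<^esub> ?T" and wuv: "w \<in> u \<boxplus>\<^bsub>V\<^esub> v"
      using w unfolding set_hadd_def[of V "?A \<uplus>\<^bsub>V\<^esub> ?B"] by blast
    \<comment> \<open>This is where strong left distributivity enters: it supplies one coefficient
      \<open>c\<close> with \<open>u\<close> in \<open>c\<close> times \<open>x\<close>, which the
      plain inclusion axiom does not give.\<close>
    have "?A \<uplus>\<^bsub>V\<^esub> ?B = (\<Union>c\<in>a \<boxplus>\<^bsub>F\<^esub> b. c \<circledast>\<^bsub>V\<^esub> x)"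
      using sld a b x by (auto simp: strongly_left_distributive_def)
    then obtain c where c: "c \<in> a \<boxplus>\<^bsub>F\<^esub> b" "u \<in> c \<circledast>\<^bsub>V\<^esub> x" using u by blast
    have cF: "c \<in> carrier F" using c(1) F.hadd_closed[OF a b] by blast
    have "v \<in> HL F V xs" using v Cons by auto
    then obtain cs where cs: "length cs = length xs" "set cs \<subseteq> carrier F" "v \<in> hlincomb V cs xs"
      unfolding mem_HL_iff by blast
    have "w \<in> hlincomb V (c # cs) (x # xs)"
      unfolding hlincomb_Cons[OF cF x] using wuv c(2) cs(3) by (auto simp: set_hadd_def)
    then show ?thesis
      unfolding mem_HL_iff using cs cF by (intro exI[of _ "c # cs"]) simp
  qed
  ultimately show ?case
    unfolding hlincomb_Cons[OF a x] hlincomb_Cons[OF b x] by (metis subsetI)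
qed

lemma HL_hadd:
  assumes "strongly_left_distributive F V" "set xs \<subseteq> carrier V"
    and "u \<in> HL F V xs" "v \<in> HL F V xs"
  shows "u \<boxplus>\<^bsub>V\<^esub> v \<subseteq> HL F V xs"
proof -
  obtain as bs where as: "length as = length xs" "set as \<subseteq> carrier F" "u \<in> hlincomb V as xs"
    and bs: "length bs = length xs" "set bs \<subseteq> carrier F" "v \<in> hlincomb V bs xs"
    using assms(3,4) by (auto simp: mem_HL_iff)
  have "u \<boxplus>\<^bsub>V\<^esub> v \<subseteq> hlincomb V as xs \<uplus>\<^bsub>V\<^esub> hlincomb V bs xs"
    using as(3) bs(3) by (auto simp: set_hadd_def)
  also have "\<dots> \<subseteq> HL F V xs"
    using hlincomb_add[OF assms(1) _ bs(1) as(2) bs(2) assms(2)] as(1) bs(1) by simp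
  finally show ?thesis .
qed

section \<open>Dropping a redundant generator\<close>

lemma dependent_mem_HL:
  assumes "set (xs @ x # ys) \<subseteq> carrier V"
    and "length as = length xs" "length bs = length ys" "set (as @ a # bs) \<subseteq> carrier F"
    and "a \<noteq> \<zero>\<^bsub>F\<^esub>" and "\<zero>\<^bsub>V\<^esub> \<in> hlincomb V (as @ a # bs) (xs @ x # ys)"
  shows "x \<in> HL F V (xs @ ys)"
proof -
  have a: "a \<in> carrier F" and x: "x \<in> carrier V"
    and F: "set (as @ bs) \<subseteq> carrier F" and V: "set (xs @ ys) \<subseteq> carrier V"
    using assms by auto
  have "\<zero>\<^bsub>V\<^esub> \<in> (a \<circledast>\<^bsub>V\<^esub> x) \<uplus>\<^bsub>V\<^esub> hlincomb V (as @ bs) (xs @ ys)"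
    using assms a x by (simp add: hlincomb_middle)
  then obtain \<beta> \<gamma> where \<beta>: "\<beta> \<in> a \<circledast>\<^bsub>V\<^esub> x" and \<gamma>: "\<gamma> \<in> hlincomb V (as @ bs) (xs @ ys)"
    and 0: "\<zero>\<^bsub>V\<^esub> \<in> \<beta> \<boxplus>\<^bsub>V\<^esub> \<gamma>"
    by (auto simp: set_hadd_def)
  have \<beta>V: "\<beta> \<in> carrier V" using \<beta> hsmul_closed[OF a x] by blast
  have \<gamma>V: "\<gamma> \<in> carrier V" using \<gamma> hlincomb_closed[OF F V] by blast
  have \<gamma>HL: "\<gamma> \<in> HL F V (xs @ ys)"
    unfolding mem_HL_iff using \<gamma> F assms(2,3) by (intro exI[of _ "as @ bs"]) simp
  obtain m where m: "m \<in> carrier F" "\<zero>\<^bsub>F\<^esub> \<in> \<one>\<^bsub>F\<^esub> \<boxplus>\<^bsub>F\<^esub> m"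
    by (rule F.hneg_exists[OF hone_closed])
  \<comment> \<open>Identifying \<beta> as the negative of \<gamma> places it in \<open>m\<close>
    times \<gamma>, hence in the span of the other vectors.\<close>
  have "\<boxminus>\<^bsub>V\<^esub> \<gamma> = \<beta>" using V.hneg_eq[OF \<gamma>V \<beta>V] 0 V.hadd_comm[OF \<beta>V \<gamma>V] by simp
  then have \<beta>HL: "\<beta> \<in> HL F V (xs @ ys)"
    using hneg_in_smult[OF m \<gamma>V] HL_smult[OF m(1) V \<gamma>HL] by blast
  obtain b where b: "b \<in> carrier F" "a \<odot>\<^bsub>F\<^esub> b = \<one>\<^bsub>F\<^esub>" using hinverse_ex[OF a assms(5)] by blast
  have "b \<circledast>\<^bsub>V\<^esub> \<beta> \<subseteq> (b \<odot>\<^bsub>F\<^esub> a) \<circledast>\<^bsub>V\<^esub> x"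
    using smult_assoc[OF b(1) a x] \<beta> by blast
  also have "\<dots> = {x}" using b hmult_comm[OF a b(1)] smult_one[OF x] by simp
  finally have "x \<in> b \<circledast>\<^bsub>V\<^esub> \<beta>" using hsmul_nonempty[OF b(1) \<beta>V] by blast
  then show ?thesis using HL_smult[OF b(1) V \<beta>HL] by blast
qed

text \<open>A combination is a sum of a multiple of \<open>x\<close> and a combination of the
  remaining vectors. Since \<open>x\<close> lies in the span of the latter, so does its multiple,
  and closure under hyperaddition finishes the argument.\<close>

lemma HL_remove:
  assumes "strongly_left_distributive F V" "set (xs @ x # ys) \<subseteq> carrier V"
    and "x \<in> HL F V (xs @ ys)"
  shows "HL F V (xs @ x # ys) \<subseteq> HL F V (xs @ ys)"
proof
  fix v assume "v \<in> HL F V (xs @ x # ys)"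
  then obtain cs where cs: "length cs = length (xs @ x # ys)" "set cs \<subseteq> carrier F"
    "v \<in> hlincomb V cs (xs @ x # ys)"
    unfolding mem_HL_iff by blast
  have V: "set (xs @ ys) \<subseteq> carrier V" using assms(2) by auto
  \<comment> \<open>The coefficient list is cut at the position of \<open>x\<close>.\<close>
  define as c bs where "as = take (length xs) cs" and "c = cs ! length xs"
    and "bs = drop (Suc (length xs)) cs"
  have split: "cs = as @ c # bs"
    unfolding as_def c_def bs_def using cs(1) by (intro id_take_nth_drop) simp
  have len: "length as = length xs" "length bs = length ys"
    unfolding as_def bs_def using cs(1) by auto
  have c: "c \<in> carrier F" using cs(2) split by auto
  have "v \<in> (c \<circledast>\<^bsub>V\<^esub> x) \<uplus>\<^bsub>V\<^esub> hlincomb V (as @ bs) (xs @ ys)"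
    using cs split len assms(2) by (simp add: hlincomb_middle)
  then obtain u w where u: "u \<in> c \<circledast>\<^bsub>V\<^esub> x" and w: "w \<in> hlincomb V (as @ bs) (xs @ ys)"
    and v: "v \<in> u \<boxplus>\<^bsub>V\<^esub> w"
    by (auto simp: set_hadd_def)
  have "u \<in> HL F V (xs @ ys)" using HL_smult[OF c V assms(3)] u by blast
  moreover have "w \<in> HL F V (xs @ ys)"
    unfolding mem_HL_iff using w cs(2) split len by (intro exI[of _ "as @ bs"]) auto
  ultimately show "v \<in> HL F V (xs @ ys)"
    using HL_hadd[OF assms(1) V] v by blast
qed

end

theorem theorem5p8:
  fixes F :: "('f, 'm) hyperfield_scheme"
    and V :: "('f, 'v, 'n) hypervector_space_scheme"
    and \<alpha>s :: "'v list"
  assumes "hypervector_space F V"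
    and "strongly_left_distributive F V"
    and "distinct \<alpha>s"
    and "set \<alpha>s \<subseteq> carrier V"
    and "lin_dependent F V \<alpha>s"
    and "generated_by F V \<alpha>s"
  shows "\<exists>\<beta>s. distinct \<beta>s \<and> set \<beta>s \<subset> set \<alpha>s \<and> generated_by F V \<beta>s"
proof -
  interpret hypervector_space F V by (rule assms(1))
  obtain cs a where cs: "length cs = length \<alpha>s" "set cs \<subseteq> carrier F"
    and a: "a \<in> set cs" "a \<noteq> \<zero>\<^bsub>F\<^esub>" and 0: "\<zero>\<^bsub>V\<^esub> \<in> hlincomb V cs \<alpha>s"
    using assms(5) by (auto simp: lin_dependent_def)
  obtain as bs where split: "cs = as @ a # bs" using a(1) by (meson split_list)
  \<comment> \<open>The vectors are cut at the position of the non-zero coefficient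
    \<open>a\<close>, so \<open>x\<close> is the vector to be dropped. If it is the only one,
    \<open>xs @ ys\<close> is empty and its span is the zero vector alone.\<close>
  define xs x ys where "xs = take (length as) \<alpha>s" and "x = \<alpha>s ! length as"
    and "ys = drop (Suc (length as)) \<alpha>s"
  have \<alpha>s: "\<alpha>s = xs @ x # ys"
    unfolding xs_def x_def ys_def using cs(1) split by (intro id_take_nth_drop) simp
  have len: "length as = length xs" "length bs = length ys"
    unfolding xs_def ys_def using cs(1) split by auto
  have V: "set (xs @ x # ys) \<subseteq> carrier V" using assms(4) \<alpha>s by simp
  have "x \<in> HL F V (xs @ ys)"
    using dependent_mem_HL[OF V len _ a(2)] cs(2) 0 split \<alpha>s by simp
  then have "carrier V \<subseteq> HL F V (xs @ ys)"
    using HL_remove[OF assms(2) V] assms(6) \<alpha>s by (simp add: generated_by_def)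
  moreover have "HL F V (xs @ ys) \<subseteq> carrier V" using V by (intro HL_closed) auto
  ultimately have "generated_by F V (xs @ ys)" by (auto simp: generated_by_def)
  \<comment> \<open>Distinctness keeps \<open>x\<close> from occurring again in
    \<open>xs @ ys\<close>, which makes the inclusion proper.\<close>
  moreover have "distinct (xs @ ys)" "set (xs @ ys) \<subset> set \<alpha>s"
    using assms(3) \<alpha>s by auto
  ultimately show ?thesis by blast
qed

end
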